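(* Let $g:\mathbb{R}^n\to\mathbb{R}^n$ be twice continuously differentiable in a neighbourhood of $x^*\in\mathbb{R}^n$, and suppose $g(x^* )=x^*$ and $J_g(x^* )=0$. Let $(x^k)$ be a sequence generated by $x^{k+1}=g(x^k)$ that converges to $x^*$ with $x^k\ne x^*$ for all $k$, and suppose that its asymptotic error constant $$\lambda=\lim_{k\to\infty}\frac{\|x^{k+1}-x^*\|}{\|x^k-x^*\|^2}\ \ge 0$$ exists. Then $$\frac12\,\|\mu(x^* )\|\ \le\ \lambda\ \le\ \frac12\,\|T_g(x^* )\| .$$
   Context: $\|\cdot\|$ is the Euclidean norm on $\mathbb{R}^n$ and, for matrices, the induced operator ($\ell_2$) norm. $J_g(x)$ is the Jacobian matrix of $g=(g_1,\dots,g_n)^T$ at $x$, and $\nabla^2 g_j(x)$ is the Hessian matrix of the coordinate function $g_j$ at $x$. For a symmetric matrix $A$, $\lambda_{\min}(A)$ and $\lambda_{\max}(A)$ are its smallest and largest eigenvalues. The vector $\mu(x)\in\mathbb{R}^n$ has nonnegative coordinates given, for $j=1,\dots,n$, by: $[\mu(x)]_j=0$ if $\lambda_{\min}(\nabla^2 g_j(x))<0<\lambda_{\max}(\nabla^2 g_j(x))$; $[\mu(x)]_j=\lambda_{\min}(\nabla^2 g_j(x))$ if $\lambda_{\min}(\nabla^2 g_j(x))\ge0$; $[\mu(x)]_j=|\lambda_{\max}(\nabla^2 g_j(x))|$ if $\lambda_{\max}(\nabla^2 g_j(x))\le0$. The quantity $\|T_g(x)\|$ is defined by $\|T_g(x)\|:=\sqrt{\sum_{i=1}^n\|\nabla^2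 g_i(x)\|^2}$. *)

theory Defs
  imports "HOL-Analysis.Analysis"
begin

definition gradient :: "(real ^ 'n \<Rightarrow> real) \<Rightarrow> real ^ 'n \<Rightarrow> real ^ 'n" where
  "gradient f x = (\<chi> i. frechet_derivative f (at x) (axis i 1))"

(* The (i,j) entry is the iterated partial derivative d/dx_j (d/dx_i f) at x. *)
definition hessian :: "(real ^ 'n \<Rightarrow> real) \<Rightarrow> real ^ 'n \<Rightarrow> real ^ 'n ^ 'n" where
  "hessian f x = jacobian (gradient f) (at x)"

(* Meant for open S.  The derivatives are taken with the full filter "at x", so f must be
   differentiable in the ambient space at every point of S. *)
definition twice_continuously_differentiable_on ::
    "(real ^ 'n \<Rightarrow> real) \<Rightarrow> (real ^ 'n) set \<Rightarrow> bool" where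
  "twice_continuously_differentiable_on f S \<longleftrightarrow>
     (\<forall>x\<in>S. f differentiable (at x)) \<and>
     (\<forall>x\<in>S. gradient f differentiable (at x)) \<and>
     continuous_on S (hessian f)"

(* Real eigenvalues only.  For a symmetric matrix these are all the eigenvalues, and the set is
   finite and nonempty, so Min and Max below are genuine. *)
definition eigenvalues :: "real ^ 'n ^ 'n \<Rightarrow> real set" where
  "eigenvalues A = {c. \<exists>v. v \<noteq> 0 \<and> A *v v = c *\<^sub>R v}"

definition lambda_min :: "real ^ 'n ^ 'n \<Rightarrow> real" where
  "lambda_min A = Min (eigenvalues A)"

definition lambda_max :: "real ^ 'n ^ 'n \<Rightarrow> real" where
  "lambda_max A = Max (eigenvalues A)"

(* If lambda_min \<ge> 0 and lambda_max \<le> 0 both hold, both branches give 0, so the order of the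
   cases is immaterial. *)
definition mu :: "(real ^ 'n \<Rightarrow> real ^ 'n) \<Rightarrow> real ^ 'n \<Rightarrow> real ^ 'n" where
  "mu g x = (\<chi> j. let H = hessian (\<lambda>y. g y $ j) x in
     if lambda_min H < 0 \<and> 0 < lambda_max H then 0
     else if lambda_min H \<ge> 0 then lambda_min H
     else \<bar>lambda_max H\<bar>)"

definition norm_T :: "(real ^ 'n \<Rightarrow> real ^ 'n) \<Rightarrow> real ^ 'n \<Rightarrow> real" where
  "norm_T g x = sqrt (\<Sum>i\<in>UNIV. (onorm ((*v) (hessian (\<lambda>y. g y $ i) x)))\<^sup>2)"

end

theory Submission
  imports Defs
begin

text \<open>
  Write \<open>h = x\<^sub>k - x\<^sup>*\<close> and let \<open>H\<^sub>j\<close> be the Hessian of \<open>g\<^sub>j\<close> at the fixed point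
  \<open>x\<^sup>*\<close>. Because the Jacobian vanishes there, the Taylor expansion of each coordinate starts with its
  quadratic term (\<open>second_order_Taylor\<close>, \<open>gradient_coordinate_eq_0\<close>):
  \<open>g\<^sub>j(x\<^sub>k) - x\<^sup>*\<^sub>j = (H\<^sub>j h \<bullet> h) / 2 + o(\<parallel>h\<parallel>\<^sup>2)\<close>.
  After division by \<open>\<parallel>h\<parallel>\<^sup>2\<close>, the quotient whose limit is \<open>\<lambda>\<close> therefore differs by a null sequence
  from half the norm of the vector \<open>w\<^sub>k\<close> of Rayleigh quotients \<open>(H\<^sub>j h \<bullet> h) / \<parallel>h\<parallel>\<^sup>2\<close>. So \<open>\<lambda>\<close> is the
  limit of \<open>\<parallel>w\<^sub>k\<parallel> / 2\<close>, and it suffices to enclose every single \<open>\<parallel>w\<^sub>k\<parallel>\<close>, which can be done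
  coordinate by coordinate.

  The upper bound is Cauchy-Schwarz: a Rayleigh quotient is at most the operator norm in absolute
  value. For the lower bound, the Rayleigh quotients of a symmetric matrix lie between its extreme
  eigenvalues, and \<open>\<mu>\<^sub>j\<close> is the distance from \<open>0\<close> to the interval that these span, so
  no Rayleigh quotient of \<open>H\<^sub>j\<close> is smaller than \<open>\<mu>\<^sub>j\<close> in absolute value
  (\<open>mu_le_abs_quadratic_form\<close>). This needs the symmetry of the Hessian, which is obtained here from
  differentiability of the gradient at the single point \<open>x\<^sup>*\<close>
  (\<open>derivative_of_gradient_self_adjoint\<close>).
\<close>

section \<open>Second-order behaviour at a point where the gradient is differentiable\<close>

lemma has_real_derivative_along_line:
  fixes f :: "'a::real_inner \<Rightarrow> real"
  assumes "(f has_derivative (\<lambda>h. G \<bullet> h)) (at (p + t *\<^sub>R u))"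
  shows "((\<lambda>s. f (p + s *\<^sub>R u)) has_real_derivative G \<bullet> u) (at t)"
proof -
  have line: "((\<lambda>s. p + s *\<^sub>R u) has_derivative (\<lambda>s. s *\<^sub>R u)) (at t)"
    by (auto intro!: derivative_eq_intros)
  have "((\<lambda>s. f (p + s *\<^sub>R u)) has_derivative (\<lambda>s. G \<bullet> (s *\<^sub>R u))) (at t)"
    using has_derivative_compose[OF line assms] by simp
  then show ?thesis
    by (simp add: has_field_derivative_def mult.commute[of _ "G \<bullet> u"])
qed

text \<open>
  Subtracting the expected quadratic polynomial from \<open>f\<close> along the segment from \<open>a\<close> to \<open>y\<close> leaves a
  function of one variable whose derivative is exactly the linearisation error of \<open>G\<close>, paired with
  \<open>y - a\<close>. One application of the mean value theorem then gives the remainder.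
\<close>

lemma second_order_Taylor:
  fixes f :: "'a::real_inner \<Rightarrow> real"
  assumes U: "open U" "a \<in> U"
    and f: "\<And>y. y \<in> U \<Longrightarrow> (f has_derivative (\<lambda>h. G y \<bullet> h)) (at y)"
    and G: "(G has_derivative L) (at a)"
    and "e > 0"
  shows "eventually (\<lambda>y. \<bar>f y - f a - G a \<bullet> (y - a) - 1/2 * (L (y - a) \<bullet> (y - a))\<bar>
            \<le> e * (norm (y - a))\<^sup>2) (nhds a)"
proof -
  have lin: "bounded_linear L"
    using G has_derivative_bounded_linear by blast
  obtain d1 where d1: "d1 > 0"
      "\<And>y. norm (y - a) < d1 \<Longrightarrow> norm (G y - G a - L (y - a)) \<le> e * norm (y - a)"
    using G \<open>e > 0\<close> unfolding has_derivative_at_alt by blast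
  obtain d2 where d2: "d2 > 0" "ball a d2 \<subseteq> U"
    using U open_contains_ball by blast
  have "\<bar>f y - f a - G a \<bullet> (y - a) - 1/2 * (L (y - a) \<bullet> (y - a))\<bar> \<le> e * (norm (y - a))\<^sup>2"
    if "dist y a < min d1 d2" for y
  proof -
    define h where "h = y - a"
    have small: "norm h < d1" "norm h < d2"
      using that by (auto simp: h_def dist_norm)
    have scaled: "norm (t *\<^sub>R h) \<le> norm h" if "0 \<le> t" "t \<le> 1" for t
      using that by (simp add: mult_left_le_one_le)
    define F where "F = (\<lambda>t. f (a + t *\<^sub>R h) - t * (G a \<bullet> h) - 1/2 * t\<^sup>2 * (L h \<bullet> h))"
    have "(F has_real_derivative (G (a + t *\<^sub>R h) - G a - L (t *\<^sub>R h)) \<bullet> h) (at t)"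
      if "0 \<le> t" "t \<le> 1" for t
    proof -
      have "a + t *\<^sub>R h \<in> U"
        using d2 small scaled[OF that] by (auto simp: dist_norm intro!: subsetD[OF d2(2)])
      note line = has_real_derivative_along_line[OF f[OF this]]
      show ?thesis unfolding F_def
        by (auto intro!: derivative_eq_intros line
            simp: linear_simps[OF lin] inner_diff_left power2_eq_square)
    qed
    then obtain t where t: "0 < t" "t < 1"
      and mv: "F 1 - F 0 = (1 - 0) * ((G (a + t *\<^sub>R h) - G a - L (t *\<^sub>R h)) \<bullet> h)"
      using MVT2[of 0 1 F "\<lambda>t. (G (a + t *\<^sub>R h) - G a - L (t *\<^sub>R h)) \<bullet> h"] by auto
    have th: "norm (t *\<^sub>R h) \<le> norm h"
      using scaled t by simp
    have "\<bar>F 1 - F 0\<bar> \<le> norm (G (a + t *\<^sub>R h) - G a - L (t *\<^sub>R h)) * norm h"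
      unfolding mv using Cauchy_Schwarz_ineq2 by simp
    also have "\<dots> \<le> (e * norm (t *\<^sub>R h)) * norm h"
      using d1(2)[of "a + t *\<^sub>R h"] th small by (intro mult_right_mono) auto
    also have "\<dots> \<le> (e * norm h) * norm h"
      using th \<open>e > 0\<close> by (intro mult_right_mono mult_left_mono) auto
    finally show ?thesis
      by (simp add: F_def h_def power2_eq_square algebra_simps)
  qed
  then show ?thesis
    unfolding eventually_nhds_metric using d1(1) d2(1) by (metis min_less_iff_conj)
qed

text \<open>
  The second difference over the parallelogram spanned by \<open>t *\<^sub>R u\<close> and \<open>t *\<^sub>R v\<close> is an increment in
  direction \<open>u\<close> of the function \<open>y \<mapsto> f (y + t *\<^sub>R v) - f y\<close>. The mean value theorem turns it into a
  difference of gradients, each of which is linearised at the common base point \<open>a\<close>; the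
  contributions of \<open>u\<close> cancel and \<open>L v \<bullet> u\<close> remains.
\<close>

lemma second_difference_estimate:
  fixes f :: "'a::real_inner \<Rightarrow> real"
  assumes U: "open U" "a \<in> U"
    and f: "\<And>y. y \<in> U \<Longrightarrow> (f has_derivative (\<lambda>h. G y \<bullet> h)) (at y)"
    and G: "(G has_derivative L) (at a)"
    and "e > 0"
  shows "eventually (\<lambda>t. \<bar>f (a + t *\<^sub>R u + t *\<^sub>R v) - f (a + t *\<^sub>R u) - f (a + t *\<^sub>R v) + f a
            - t\<^sup>2 * (L v \<bullet> u)\<bar> \<le> 2 * e * (norm u + norm v)\<^sup>2 * t\<^sup>2) (at_right 0)"
proof -
  define C where "C = norm u + norm v"
  have lin: "bounded_linear L"
    using G has_derivative_bounded_linear by blast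
  obtain d1 where d1: "d1 > 0"
      "\<And>y. norm (y - a) < d1 \<Longrightarrow> norm (G y - G a - L (y - a)) \<le> e * norm (y - a)"
    using G \<open>e > 0\<close> unfolding has_derivative_at_alt by blast
  obtain d2 where d2: "d2 > 0" "ball a d2 \<subseteq> U"
    using U open_contains_ball by blast
  \<comment> \<open>Every point of the parallelogram is within \<open>t * C\<close> of \<open>a\<close>; the extra \<open>1\<close> avoids division by
    zero when \<open>u\<close> and \<open>v\<close> both vanish.\<close>
  define d where "d = min d1 d2 / (C + 1)"
  have "C \<ge> 0" by (simp add: C_def)
  then have "d > 0" using d1 d2 by (simp add: d_def)
  have "\<bar>f (a + t *\<^sub>R u + t *\<^sub>R v) - f (a + t *\<^sub>R u) - f (a + t *\<^sub>R v) + f a - t\<^sup>2 * (L v \<bullet> u)\<bar>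
          \<le> 2 * e * C\<^sup>2 * t\<^sup>2" if t: "0 < t" "t < d" for t
  proof -
    have "t * (C + 1) < min d1 d2"
      using t \<open>C \<ge> 0\<close> by (simp add: d_def pos_less_divide_eq)
    then have tC: "t * C < d1" "t * C < d2"
      using t by (auto simp: algebra_simps)
    define r where "r = (\<lambda>y. G y - G a - L (y - a))"
    have near: "norm (s *\<^sub>R u + c *\<^sub>R v) \<le> t * C" if "0 \<le> s" "s \<le> t" "0 \<le> c" "c \<le> t" for s c
    proof -
      have "norm (s *\<^sub>R u + c *\<^sub>R v) \<le> s * norm u + c * norm v"
        using norm_triangle_ineq[of "s *\<^sub>R u" "c *\<^sub>R v"] that by simp
      also have "\<dots> \<le> t * norm u + t * norm v"
        using that by (intro add_mono mult_right_mono) auto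
      finally show ?thesis by (simp add: C_def algebra_simps)
    qed
    have rb: "norm (r (a + s *\<^sub>R u + c *\<^sub>R v)) \<le> e * (t * C)"
      if "0 \<le> s" "s \<le> t" "0 \<le> c" "c \<le> t" for s c
    proof -
      have "norm (r (a + (s *\<^sub>R u + c *\<^sub>R v))) \<le> e * norm (s *\<^sub>R u + c *\<^sub>R v)"
        using d1(2)[of "a + (s *\<^sub>R u + c *\<^sub>R v)"] near[OF that] tC by (simp add: r_def)
      also have "\<dots> \<le> e * (t * C)"
        using near[OF that] \<open>e > 0\<close> by (intro mult_left_mono) auto
      finally show ?thesis by (simp add: add.assoc)
    qed
    have mem: "a + c *\<^sub>R v + s *\<^sub>R u \<in> U" if "0 \<le> s" "s \<le> t" "0 \<le> c" "c \<le> t" for s c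
    proof (rule subsetD[OF d2(2)])
      have "dist a (a + c *\<^sub>R v + s *\<^sub>R u) = norm (s *\<^sub>R u + c *\<^sub>R v)"
        by (simp add: dist_norm norm_minus_commute algebra_simps)
      then show "a + c *\<^sub>R v + s *\<^sub>R u \<in> ball a d2"
        using near[OF that] tC by simp
    qed
    define F where "F = (\<lambda>s. f (a + t *\<^sub>R v + s *\<^sub>R u) - f (a + s *\<^sub>R u))"
    have "(F has_real_derivative (G (a + t *\<^sub>R v + s *\<^sub>R u) - G (a + s *\<^sub>R u)) \<bullet> u) (at s)"
      if "0 \<le> s" "s \<le> t" for s
      unfolding F_def inner_diff_left
      using mem[OF that, of t] mem[OF that, of 0] t
      by (intro DERIV_diff has_real_derivative_along_line f) auto
    then obtain s where s: "0 < s" "s < t"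
      and mv: "F t - F 0 = (t - 0) * ((G (a + t *\<^sub>R v + s *\<^sub>R u) - G (a + s *\<^sub>R u)) \<bullet> u)"
      using MVT2[of 0 t F "\<lambda>s. (G (a + t *\<^sub>R v + s *\<^sub>R u) - G (a + s *\<^sub>R u)) \<bullet> u"] t by auto
    have split: "G (a + t *\<^sub>R v + s *\<^sub>R u) - G (a + s *\<^sub>R u)
          = t *\<^sub>R L v + (r (a + s *\<^sub>R u + t *\<^sub>R v) - r (a + s *\<^sub>R u + 0 *\<^sub>R v))"
      by (simp add: r_def linear_simps[OF lin] algebra_simps)
    have "F t - F 0 - t\<^sup>2 * (L v \<bullet> u)
          = t * ((r (a + s *\<^sub>R u + t *\<^sub>R v) - r (a + s *\<^sub>R u + 0 *\<^sub>R v)) \<bullet> u)"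
      unfolding mv split by (simp add: inner_add_left algebra_simps power2_eq_square)
    moreover have "\<bar>(r (a + s *\<^sub>R u + t *\<^sub>R v) - r (a + s *\<^sub>R u + 0 *\<^sub>R v)) \<bullet> u\<bar>
          \<le> (2 * (e * (t * C))) * C"
    proof -
      have "\<bar>(r (a + s *\<^sub>R u + t *\<^sub>R v) - r (a + s *\<^sub>R u + 0 *\<^sub>R v)) \<bullet> u\<bar>
          \<le> norm (r (a + s *\<^sub>R u + t *\<^sub>R v) - r (a + s *\<^sub>R u + 0 *\<^sub>R v)) * norm u"
        by (rule Cauchy_Schwarz_ineq2)
      also have "\<dots> \<le> (2 * (e * (t * C))) * C"
      proof (rule mult_mono)
        show "norm (r (a + s *\<^sub>R u + t *\<^sub>R v) - r (a + s *\<^sub>R u + 0 *\<^sub>R v)) \<le> 2 * (e * (t * C))"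
          using norm_triangle_ineq4[of "r (a + s *\<^sub>R u + t *\<^sub>R v)" "r (a + s *\<^sub>R u + 0 *\<^sub>R v)"]
            rb[of s t] rb[of s 0] s t by linarith
      qed (use t \<open>e > 0\<close> \<open>C \<ge> 0\<close> in \<open>auto simp: C_def\<close>)
      finally show ?thesis .
    qed
    ultimately have "\<bar>F t - F 0 - t\<^sup>2 * (L v \<bullet> u)\<bar> \<le> t * ((2 * (e * (t * C))) * C)"
      using t by (simp add: abs_mult)
    then show ?thesis
      by (simp add: F_def power2_eq_square algebra_simps)
  qed
  then show ?thesis
    unfolding eventually_at_right_field C_def using \<open>d > 0\<close> by blast
qed

text \<open>
  The second difference is unchanged when \<open>u\<close> and \<open>v\<close> are exchanged, whereas its leading term
  changes from \<open>L v \<bullet> u\<close> to \<open>L u \<bullet> v\<close>; so the two agree. In finite dimension this is the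
  symmetry of the Hessian at \<open>a\<close>.
\<close>

lemma derivative_of_gradient_self_adjoint:
  fixes f :: "'a::real_inner \<Rightarrow> real"
  assumes U: "open U" "a \<in> U"
    and f: "\<And>y. y \<in> U \<Longrightarrow> (f has_derivative (\<lambda>h. G y \<bullet> h)) (at y)"
    and G: "(G has_derivative L) (at a)"
  shows "L u \<bullet> v = u \<bullet> L v"
proof -
  define K where "K = 4 * (norm u + norm v)\<^sup>2"
  have bound: "\<bar>L v \<bullet> u - L u \<bullet> v\<bar> \<le> e * K" if "e > 0" for e
  proof -
    have estimate: "eventually (\<lambda>t. \<bar>f (a + t *\<^sub>R p + t *\<^sub>R q) - f (a + t *\<^sub>R p) - f (a + t *\<^sub>R q) + f a
        - t\<^sup>2 * (L q \<bullet> p)\<bar> \<le> 2 * e * (norm p + norm q)\<^sup>2 * t\<^sup>2) (at_right 0)" for p q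
      by (rule second_difference_estimate[OF U f G that])
    have "eventually (\<lambda>t. \<bar>L v \<bullet> u - L u \<bullet> v\<bar> \<le> e * K) (at_right (0::real))"
      using estimate[of u v] estimate[of v u] eventually_at_right_less[of 0]
    proof eventually_elim
      case (elim t)
      have "\<bar>t\<^sup>2 * (L v \<bullet> u) - t\<^sup>2 * (L u \<bullet> v)\<bar>
          \<le> 2 * e * (norm u + norm v)\<^sup>2 * t\<^sup>2 + 2 * e * (norm v + norm u)\<^sup>2 * t\<^sup>2"
        using elim(1,2) by (simp add: add.assoc add.commute[of "t *\<^sub>R v" "t *\<^sub>R u"])
      also have "\<dots> = t\<^sup>2 * (e * K)"
        by (simp add: K_def algebra_simps)
      finally have "t\<^sup>2 * \<bar>L v \<bullet> u - L u \<bullet> v\<bar> \<le> t\<^sup>2 * (e * K)"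
        by (simp add: abs_mult flip: right_diff_distrib)
      then show ?case
        using elim(3) by simp
    qed
    then show ?thesis
      by (simp add: trivial_limit_at_right_real)
  qed
  have "((\<lambda>e. e * K) \<longlongrightarrow> 0 * K) (at_right 0)"
    by (intro tendsto_intros)
  then have "\<bar>L v \<bullet> u - L u \<bullet> v\<bar> \<le> 0 * K"
    by (rule tendsto_lowerbound)
      (auto intro: eventually_mono[OF eventually_at_right_less] bound)
  then show ?thesis
    by (simp add: inner_commute)
qed

section \<open>Extreme eigenvalues of a symmetric matrix bound its quadratic form\<close>

text \<open>
  Eigenvectors of a symmetric matrix for distinct eigenvalues are orthogonal, and an orthogonal
  family of nonzero vectors in a finite-dimensional space is finite. Finiteness and the existence of
  an eigenvalue are what make \<open>Min\<close> and \<open>Max\<close> of the spectrum meaningful.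
\<close>

lemma finite_eigenvalues_symmetric:
  fixes A :: "real ^ 'n ^ 'n"
  assumes sym: "\<And>u v. (A *v u) \<bullet> v = u \<bullet> (A *v v)"
  shows "finite (eigenvalues A)"
proof -
  define w where "w = (\<lambda>c. SOME v. v \<noteq> 0 \<and> A *v v = c *\<^sub>R v)"
  have w: "w c \<noteq> 0" "A *v w c = c *\<^sub>R w c" if "c \<in> eigenvalues A" for c
    using someI_ex[of "\<lambda>v. v \<noteq> 0 \<and> A *v v = c *\<^sub>R v"] that
    by (auto simp: eigenvalues_def w_def)
  have orth: "w c \<bullet> w d = 0" if "c \<in> eigenvalues A" "d \<in> eigenvalues A" "c \<noteq> d" for c d
    using sym[of "w c" "w d"] that by (simp add: w)
  have "inj_on w (eigenvalues A)"
    using orth w(1) by (metis inj_onI inner_eq_zero_iff)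
  moreover have "independent (w ` eigenvalues A)"
    by (rule pairwise_orthogonal_independent)
      (use orth w(1) in \<open>auto simp: pairwise_def orthogonal_def\<close>)
  ultimately show ?thesis
    using independent_imp_finite finite_imageD by blast
qed

text \<open>
  The variational characterisation of the least eigenvalue: the minimum \<open>m\<close> of the quadratic form
  on the unit sphere is attained by compactness, and a minimiser \<open>v\<close> is an eigenvector. Otherwise
  the residual \<open>z = A *v v - m *\<^sub>R v\<close> would be a descent direction, since moving from \<open>v\<close> to
  \<open>v - t *\<^sub>R z\<close> changes \<open>(A *v v) \<bullet> v - m * (v \<bullet> v)\<close>, which is \<open>0\<close> at its minimum, by
  \<open>- 2 * t * (z \<bullet> z)\<close> to first order in \<open>t\<close>.
\<close>

lemma exists_eigenvalue_below_quadratic_form: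
  fixes A :: "real ^ 'n ^ 'n"
  assumes sym: "\<And>u v. (A *v u) \<bullet> v = u \<bullet> (A *v v)"
  shows "\<exists>m\<in>eigenvalues A. \<forall>h. m * (norm h)\<^sup>2 \<le> (A *v h) \<bullet> h"
proof -
  have "sphere (0::real^'n) 1 \<noteq> {}" by simp
  moreover have "continuous_on (sphere 0 1) (\<lambda>v. (A *v v) \<bullet> v)"
    by (intro continuous_on_inner continuous_on_id matrix_vector_mult_linear_continuous_on)
  ultimately obtain v where "v \<in> sphere 0 1"
      and "\<forall>u\<in>sphere 0 1. (A *v v) \<bullet> v \<le> (A *v u) \<bullet> u"
    using continuous_attains_inf[OF compact_sphere] by blast
  then have v: "norm v = 1"
    and least: "\<And>u. norm u = 1 \<Longrightarrow> (A *v v) \<bullet> v \<le> (A *v u) \<bullet> u"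
    by auto
  define m where "m = (A *v v) \<bullet> v"
  have below: "m * (norm h)\<^sup>2 \<le> (A *v h) \<bullet> h" for h
  proof (cases "h = 0")
    case False
    have "m \<le> (A *v (h /\<^sub>R norm h)) \<bullet> (h /\<^sub>R norm h)"
      unfolding m_def using False by (intro least) simp
    also have "\<dots> = ((A *v h) \<bullet> h) / (norm h)\<^sup>2"
      by (simp add: matrix_vector_mult_scaleR power2_eq_square field_simps)
    finally show ?thesis
      using False by (simp add: field_simps)
  qed simp
  define z where "z = A *v v - m *\<^sub>R v"
  have Av: "A *v v = z + m *\<^sub>R v"
    by (simp add: z_def)
  define q where "q = (A *v z) \<bullet> z - m * (z \<bullet> z)"
  have "z \<bullet> z \<le> t * (q / 2)" if "t > 0" for t :: real
  proof -
    have vv: "v \<bullet> v = 1"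
      using v by (simp flip: power2_norm_eq_inner)
    have Azv: "(A *v z) \<bullet> v = (A *v v) \<bullet> z"
      using sym[of z v] by (simp add: inner_commute)
    have Avz: "(A *v v) \<bullet> z = z \<bullet> z + m * (v \<bullet> z)"
      unfolding Av by (simp add: inner_add_left)
    have "(A *v (v - t *\<^sub>R z)) \<bullet> (v - t *\<^sub>R z)
        = (A *v v) \<bullet> v - t * ((A *v v) \<bullet> z) - t * ((A *v z) \<bullet> v) + t * (t * ((A *v z) \<bullet> z))"
      by (simp add: matrix_vector_mult_diff_distrib matrix_vector_mult_scaleR inner_diff_left
          inner_diff_right right_diff_distrib)
    then have form: "(A *v (v - t *\<^sub>R z)) \<bullet> (v - t *\<^sub>R z)
        = m - 2 * (t * (z \<bullet> z)) - 2 * (t * (m * (v \<bullet> z))) + t * (t * ((A *v z) \<bullet> z))"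
      by (simp only: Azv Avz m_def[symmetric]) (simp add: algebra_simps)
    have "(v - t *\<^sub>R z) \<bullet> (v - t *\<^sub>R z) = 1 - 2 * (t * (v \<bullet> z)) + t * (t * (z \<bullet> z))"
      by (simp add: inner_diff_left inner_diff_right right_diff_distrib vv
          inner_commute[of z v])
    then have "m * (1 - 2 * (t * (v \<bullet> z)) + t * (t * (z \<bullet> z)))
        \<le> m - 2 * (t * (z \<bullet> z)) - 2 * (t * (m * (v \<bullet> z))) + t * (t * ((A *v z) \<bullet> z))"
      using below[of "v - t *\<^sub>R z"] by (simp add: form power2_norm_eq_inner)
    then have "t * (z \<bullet> z) \<le> t * (t * (q / 2))"
      by (simp add: q_def algebra_simps)
    then show ?thesis
      using that by (simp only: mult_le_cancel_left_pos)
  qed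
  moreover have "((\<lambda>t. t * (q / 2)) \<longlongrightarrow> 0 * (q / 2)) (at_right 0)"
    by (intro tendsto_intros)
  ultimately have "z \<bullet> z \<le> 0 * (q / 2)"
    by (intro tendsto_lowerbound[where F = "at_right (0::real)"])
      (auto intro: eventually_mono[OF eventually_at_right_less])
  then have "z = 0"
    using inner_gt_zero_iff[of z] by fastforce
  then have "m \<in> eigenvalues A"
    unfolding eigenvalues_def z_def using v by (auto intro!: exI[of _ v])
  then show ?thesis
    using below by blast
qed

lemma uminus_matrix_vector_mult: "(- A) *v v = - (A *v v)" for A :: "real ^ 'n ^ 'm"
  by (simp add: matrix_vector_mult_def vec_eq_iff sum_negf)

lemma eigenvalues_uminus: "eigenvalues (- A) = uminus ` eigenvalues A"
proof -
  have iff: "c \<in> eigenvalues (- A) \<longleftrightarrow> - c \<in> eigenvalues A" for c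
    unfolding eigenvalues_def uminus_matrix_vector_mult by (auto simp: minus_equation_iff[of "A *v _"])
  show ?thesis
  proof (intro set_eqI iffI)
    fix c assume "c \<in> eigenvalues (- A)"
    then show "c \<in> uminus ` eigenvalues A"
      unfolding iff by (intro image_eqI[of _ _ "- c"]) auto
  qed (auto simp: iff)
qed

lemma lambda_min_le_quadratic_form:
  fixes A :: "real ^ 'n ^ 'n"
  assumes sym: "\<And>u v. (A *v u) \<bullet> v = u \<bullet> (A *v v)"
  shows "lambda_min A * (norm h)\<^sup>2 \<le> (A *v h) \<bullet> h"
proof -
  obtain m where m: "m \<in> eigenvalues A" "m * (norm h)\<^sup>2 \<le> (A *v h) \<bullet> h"
    using exists_eigenvalue_below_quadratic_form[OF sym] by blast
  have "lambda_min A \<le> m"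
    unfolding lambda_min_def using finite_eigenvalues_symmetric[OF sym] m(1) by simp
  then show ?thesis
    using m(2) mult_right_mono[of "lambda_min A" m "(norm h)\<^sup>2"] by simp
qed

lemma quadratic_form_le_lambda_max:
  fixes A :: "real ^ 'n ^ 'n"
  assumes sym: "\<And>u v. (A *v u) \<bullet> v = u \<bullet> (A *v v)"
  shows "(A *v h) \<bullet> h \<le> lambda_max A * (norm h)\<^sup>2"
proof -
  obtain m where m: "m \<in> eigenvalues (- A)" "m * (norm h)\<^sup>2 \<le> ((- A) *v h) \<bullet> h"
    using exists_eigenvalue_below_quadratic_form[of "- A"] sym by (auto simp: uminus_matrix_vector_mult)
  have "- m \<le> lambda_max A"
    unfolding lambda_max_def using finite_eigenvalues_symmetric[OF sym] m(1)
    by (intro Max_ge) (auto simp: eigenvalues_uminus)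
  then show ?thesis
    using m(2) mult_right_mono[of "- m" "lambda_max A" "(norm h)\<^sup>2"] by (simp add: uminus_matrix_vector_mult)
qed

section \<open>The asymptotic error constant\<close>

text \<open>
  The gradient is defined by partial derivatives; expanding a direction in the standard basis shows
  that it represents the whole derivative through the inner product, which is the form that the
  coordinate-free results above require.
\<close>

lemma has_derivative_gradient:
  assumes "f differentiable (at x)"
  shows "(f has_derivative (\<lambda>h. gradient f x \<bullet> h)) (at x)"
proof -
  interpret linear "frechet_derivative f (at x)"
    using assms by (rule linear_frechet_derivative)
  have "frechet_derivative f (at x) h = gradient f x \<bullet> h" for h
  proof -
    have "frechet_derivative f (at x) (\<Sum>i\<in>UNIV. (h $ i) *\<^sub>R axis i 1) = gradient f x \<bullet> h"
      by (simp add: sum scale gradient_def inner_vec_def mult.commute)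
    moreover have "(\<Sum>i\<in>UNIV. (h $ i) *\<^sub>R axis i 1) = h"
      using basis_expansion[of h] by (simp add: scalar_mult_eq_scaleR)
    ultimately show ?thesis by simp
  qed
  then show ?thesis
    using assms by (metis (no_types, lifting) ext frechet_derivative_works)
qed

lemma gradient_coordinate_eq_0:
  assumes "\<And>j. (\<lambda>y. g y $ j) differentiable (at x)" and "jacobian g (at x) = 0"
  shows "gradient (\<lambda>y. g y $ j) x = 0"
proof -
  have "g differentiable (at x)"
    using assms(1) by (subst differentiable_componentwise_within)
      (auto simp: Basis_vec_def inner_axis)
  then have "(g has_derivative (\<lambda>h. 0)) (at x)"
    using assms(2) by (simp add: jacobian_works)
  then have "((\<lambda>y. g y $ j) has_derivative (\<lambda>h. 0)) (at x)"
    using bounded_linear.has_derivative[OF bounded_linear_vec_nth[of j]] by fastforce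
  then have "frechet_derivative (\<lambda>y. g y $ j) (at x) = (\<lambda>h. 0)"
    using frechet_derivative_at by metis
  then show ?thesis
    by (simp add: gradient_def vec_eq_iff)
qed

lemma mu_nonneg: "0 \<le> mu g x $ j"
  by (simp add: mu_def Let_def)

text \<open>
  The point of \<open>mu\<close>: the Rayleigh quotients lie in the interval from \<open>lambda_min\<close> to \<open>lambda_max\<close>,
  and \<open>mu\<close> measures how far that interval stays away from \<open>0\<close>.
\<close>

lemma mu_le_abs_quadratic_form:
  fixes g :: "real ^ 'n \<Rightarrow> real ^ 'n" and x :: "real ^ 'n"
  defines "H \<equiv> \<lambda>j. hessian (\<lambda>y. g y $ j) x"
  assumes sym: "\<And>u v. (H j *v u) \<bullet> v = u \<bullet> (H j *v v)"
  shows "mu g x $ j * (norm h)\<^sup>2 \<le> \<bar>(H j *v h) \<bullet> h\<bar>"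
proof -
  note lo = lambda_min_le_quadratic_form[of "H j" h, OF sym]
  note hi = quadratic_form_le_lambda_max[of "H j" h, OF sym]
  consider "lambda_min (H j) < 0 \<and> 0 < lambda_max (H j)" | "lambda_min (H j) \<ge> 0"
    | "lambda_min (H j) < 0" "lambda_max (H j) \<le> 0" by linarith
  then show ?thesis
  proof cases
    case 1
    then show ?thesis by (simp add: mu_def H_def)
  next
    case 2
    then have "mu g x $ j = lambda_min (H j)" by (simp add: mu_def H_def)
    from lo[folded this] show ?thesis by linarith
  next
    case 3
    then have "mu g x $ j = - lambda_max (H j)" by (simp add: mu_def H_def Let_def)
    then have "lambda_max (H j) = - mu g x $ j" by simp
    from hi[unfolded this] show ?thesis by simp
  qed
qed

lemma abs_quadratic_form_le_onorm:
  fixes A :: "real ^ 'n ^ 'n"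
  shows "\<bar>(A *v h) \<bullet> h\<bar> \<le> onorm ((*v) A) * (norm h)\<^sup>2"
proof -
  have "\<bar>(A *v h) \<bullet> h\<bar> \<le> norm (A *v h) * norm h"
    by (rule Cauchy_Schwarz_ineq2)
  also have "\<dots> \<le> (onorm ((*v) A) * norm h) * norm h"
    by (intro mult_right_mono onorm matrix_vector_mul_bounded_linear) simp
  finally show ?thesis
    by (simp add: power2_eq_square mult.assoc)
qed

theorem theorem1:
  fixes g :: "real ^ 'n \<Rightarrow> real ^ 'n"
    and xstar :: "real ^ 'n"
    and U :: "(real ^ 'n) set"
    and x :: "nat \<Rightarrow> real ^ 'n"
    and lam :: real
  assumes "open U" and "xstar \<in> U"
    and "\<And>j. twice_continuously_differentiable_on (\<lambda>y. g y $ j) U"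
    and "g xstar = xstar"
    and "jacobian g (at xstar) = 0"
    and "\<And>k. x (Suc k) = g (x k)"
    and "x \<longlonglongrightarrow> xstar"
    and "\<And>k. x k \<noteq> xstar"
    and "(\<lambda>k. norm (x (Suc k) - xstar) / (norm (x k - xstar))\<^sup>2) \<longlonglongrightarrow> lam"
  shows "1 / 2 * norm (mu g xstar) \<le> lam \<and> lam \<le> 1 / 2 * norm_T g xstar"
proof -
  define H where "H = (\<lambda>j. hessian (\<lambda>y. g y $ j) xstar)"
  define h where "h = (\<lambda>k. x k - xstar)"
  have h: "norm (h k) > 0" for k
    using assms(8) by (simp add: h_def)
  have deriv: "((\<lambda>y. g y $ j) has_derivative (\<lambda>v. gradient (\<lambda>y. g y $ j) y \<bullet> v)) (at y)"
    if "y \<in> U" for j y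
    using assms(3)[of j] that has_derivative_gradient
    unfolding twice_continuously_differentiable_on_def by blast
  have deriv2: "(gradient (\<lambda>y. g y $ j) has_derivative (*v) (H j)) (at xstar)" for j
    using assms(2) assms(3)[of j]
    unfolding twice_continuously_differentiable_on_def H_def hessian_def
    by (simp add: jacobian_works)
  have sym: "(H j *v u) \<bullet> v = u \<bullet> (H j *v v)" for j u v
    by (rule derivative_of_gradient_self_adjoint[OF assms(1,2) deriv deriv2])
  have grad0: "gradient (\<lambda>y. g y $ j) xstar = 0" for j
    using gradient_coordinate_eq_0 assms(2,3,5)
    unfolding twice_continuously_differentiable_on_def by blast

  \<comment> \<open>\<open>norm (r k)\<close> is the quotient whose limit is \<open>lam\<close>, and \<open>(1/2) *\<^sub>R w k\<close> is what the Taylor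
    expansion predicts for \<open>r k\<close>.\<close>
  define r where "r = (\<lambda>k. (x (Suc k) - xstar) /\<^sub>R (norm (h k))\<^sup>2)"
  define w where "w = (\<lambda>k. (\<chi> j. ((H j *v h k) \<bullet> h k) / (norm (h k))\<^sup>2))"
  have "(\<lambda>k. r k - (1/2) *\<^sub>R w k) \<longlonglongrightarrow> 0"
  proof (rule vec_tendstoI)
    fix j
    show "(\<lambda>k. (r k - (1/2) *\<^sub>R w k) $ j) \<longlonglongrightarrow> 0 $ j"
    proof (rule tendstoI)
      fix e :: real assume "e > 0"
      then have "eventually (\<lambda>y. \<bar>g y $ j - g xstar $ j - gradient (\<lambda>y. g y $ j) xstar \<bullet> (y - xstar)
            - 1/2 * ((H j *v (y - xstar)) \<bullet> (y - xstar))\<bar>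
          \<le> (e / 2) * (norm (y - xstar))\<^sup>2) (nhds xstar)"
        by (intro second_order_Taylor[OF assms(1,2) deriv deriv2]) auto
      from eventually_compose_filterlim[OF this assms(7)]
      have "eventually (\<lambda>k. \<bar>g (x k) $ j - xstar $ j - 1/2 * ((H j *v h k) \<bullet> h k)\<bar>
          \<le> (e / 2) * (norm (h k))\<^sup>2) sequentially"
        by (simp add: grad0 assms(4) h_def)
      then show "eventually (\<lambda>k. dist ((r k - (1/2) *\<^sub>R w k) $ j) (0 $ j) < e) sequentially"
      proof eventually_elim
        case (elim k)
        have "(r k - (1/2) *\<^sub>R w k) $ j
            = (g (x k) $ j - xstar $ j - 1/2 * ((H j *v h k) \<bullet> h k)) / (norm (h k))\<^sup>2"
          by (simp add: r_def w_def assms(6) inverse_eq_divide diff_divide_distrib)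
        moreover have "\<bar>\<dots>\<bar> \<le> e / 2"
          using elim h[of k] by (simp add: abs_divide pos_divide_le_eq)
        ultimately show ?case
          using \<open>e > 0\<close> by (simp only: dist_norm zero_index diff_zero real_norm_def)
      qed
    qed
  qed
  then have "(\<lambda>k. norm (r k) - norm ((1/2) *\<^sub>R w k)) \<longlonglongrightarrow> 0"
    by (rule Lim_null_comparison[OF always_eventually tendsto_norm_zero, rotated])
      (simp only: real_norm_def norm_triangle_ineq3 simp_thms)
  moreover have "(\<lambda>k. norm (r k)) \<longlonglongrightarrow> lam"
    using assms(9) by (simp add: r_def h_def inverse_eq_divide)
  ultimately have "(\<lambda>k. norm (r k) - (norm (r k) - norm ((1/2) *\<^sub>R w k))) \<longlonglongrightarrow> lam - 0"
    by (intro tendsto_diff)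
  then have lim: "(\<lambda>k. 1/2 * norm (w k)) \<longlonglongrightarrow> lam"
    by simp

  have lower: "norm (mu g xstar) \<le> norm (w k)" for k
  proof (rule norm_le_componentwise_cart)
    fix j
    show "norm (mu g xstar $ j) \<le> norm (w k $ j)"
      using mu_le_abs_quadratic_form[where g = g and x = xstar and j = j and h = "h k"] sym h[of k]
        mu_nonneg[of g xstar j]
      by (simp add: w_def H_def abs_divide pos_le_divide_eq)
  qed
  have upper: "norm (w k) \<le> norm_T g xstar" for k
  proof -
    have "\<bar>w k $ j\<bar> \<le> onorm ((*v) (H j))" for j
      using abs_quadratic_form_le_onorm[of "H j" "h k"] h[of k]
      by (simp add: w_def abs_divide pos_divide_le_eq)
    then show ?thesis
      unfolding norm_vec_def L2_set_def norm_T_def H_def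
      by (intro real_sqrt_le_mono sum_mono power_mono) auto
  qed
  show ?thesis
    using lower upper
    by (intro conjI LIMSEQ_le_const[OF lim] LIMSEQ_le_const2[OF lim]) auto
qed

end
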